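(* Let $u$ be a positive integer, let $i\ge 2$ be an integer, and let $k$ be an even integer with $4\le k\le 2i$. Let $q=\left\lfloor uP_{2i+1}(u)/P_k(u)\right\rfloor$. Then for every integer $p$ with $0\le p\le q$, \begin{align*} &n_p\bigl(P_{2i+1}(u),P_{2i+3}(u),P_{2i+k+1}(u)\bigr)\\ &=-\frac{p^2P_k(u)P_{k-2}(u)}{2u^2}+\frac{p}{2u^2}P_k(u)\bigl(2uP_{2i+3}(u)-P_{k-2}(u)\bigr)\\ &\quad+\frac{1}{2u^2}\Bigl(u^2\bigl(P_{2i+1}(u)-1\bigr)\bigl(P_{2i+3}(u)-1\bigr)-qP_{k-2}(u)\bigl(2uP_{2i+1}(u)-(q+1)P_k(u)\bigr)\Bigr). \end{align*}
   Context: For a fixed positive integer $u$, the Pell-type numbers $P_n(u)$ are defined by $P_0(u)=0$, $P_1(u)=1$ and $P_n(u)=uP_{n-1}(u)+P_{n-2}(u)$ for $n\ge 2$. Let $A=\{a_1,\dots,a_\kappa\}$ be a set of positive integers with $\gcd(a_1,\dots,a_\kappa)=1$ and let $p$ be a nonnegative integer. $S_p(A)$ is the set of integers $n$ for which there are more than $p$ tuples $(x_1,\dots,x_\kappa)$ of nonnegative integers with $n=x_1a_1+\cdots+x_\kappa a_\kappa$. The set $\mathbb{N}_0\setminus S_p(A)$, with $\mathbb{N}_0=\{0,1,2,\dots\}$, is finite; the $p$-genus $n_p(A)=n_p(a_1,\dots,a_\kappa)$ is its cardinality. *)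

theory Defs
  imports Complex_Main "HOL-Library.FuncSet"
begin

fun pell :: "nat \<Rightarrow> nat \<Rightarrow> nat" where
  "pell u 0 = 0"
| "pell u (Suc 0) = 1"
| "pell u (Suc (Suc n)) = u * pell u (Suc n) + pell u n"

text \<open>
  A tuple of nonnegative coefficients for the elements of \<open>A\<close> is encoded as a function on \<open>A\<close>,
  extensional outside \<open>A\<close> so that every tuple is counted once.
\<close>

definition representations :: "nat set \<Rightarrow> nat \<Rightarrow> (nat \<Rightarrow> nat) set" where
  "representations A n = {x \<in> A \<rightarrow>\<^sub>E UNIV. n = (\<Sum>a\<in>A. x a * a)}"

text \<open>
  Negative integers have no representation, so the set \<open>S\<^sub>p(A)\<close> is a set of natural numbers.
  The cardinalities below are meaningful for a finite set \<open>A\<close> of positive integers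
  (finitely many representations) with gcd 1 (finite complement of \<open>S\<^sub>p(A)\<close>).
\<close>

definition p_semigroup :: "nat \<Rightarrow> nat set \<Rightarrow> nat set" where
  "p_semigroup p A = {n. card (representations A n) > p}"

definition p_genus :: "nat \<Rightarrow> nat set \<Rightarrow> nat" where
  "p_genus p A = card (UNIV - p_semigroup p A)"

end

theory Submission
  imports Defs "HOL-Number_Theory.Cong"
begin

text \<open>
  Write \<open>a\<close>, \<open>b\<close>, \<open>c\<close> for the three generators, \<open>r = P\<^sub>k / u\<close> and \<open>s = P\<^bsub>k-2\<^esub> / u\<close>. The addition
  formula for Pell-type numbers gives \<open>c + s a = r b\<close>, and the rest of the argument uses only this
  relation together with \<open>2 s \<le> r \<le> a \<le> b\<close> and the coprimality of \<open>a\<close> and \<open>b\<close>.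

  Every integer is \<open>t b + w a\<close> for a unique \<open>0 \<le> t < a\<close>. Its representations correspond to the pairs
  \<open>j, z \<ge> 0\<close> with \<open>r z \<le> t + j a\<close> and \<open>w \<ge> j b - s z\<close>. As \<open>w\<close> grows, they appear in the order
  \<open>(0, \<lfloor>t/r\<rfloor>), \<dots>, (0, 0)\<close>, then \<open>(1, \<lfloor>(t+a)/r\<rfloor>), (1, \<lfloor>(t+a)/r\<rfloor> - 1), \<dots>\<close>, and no pair with \<open>j \<ge> 2\<close> comes
  among the first \<open>q + 1\<close>. So the value of \<open>w\<close> from which there are more than \<open>p\<close> representations is
  explicit for \<open>p \<le> q\<close>, and the genus is a sum over \<open>t\<close> of floor functions.
\<close>

section \<open>Sums of floors\<close>

text \<open>With d = N div r, each m in {1..d} contributes 1 to \<open>t div r\<close> exactly for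
  the N - m r values t in {m r..<N}, so the sum is the sum of N - m r over these m. The induction
  checks this by asking whether N + 1 is the next multiple of r.\<close>

lemma sum_div_lessThan:
  fixes r :: int
  assumes "r > 0"
  shows "2 * (\<Sum>t<N. int t div r) + r * (int N div r) * (int N div r + 1) = 2 * int N * (int N div r)"
proof (induction N)
  case 0
  show ?case using assms by simp
next
  case (Suc N)
  define d where "d = int N div r"
  have "int N = d * r + int N mod r" unfolding d_def by simp
  moreover have "0 \<le> int N mod r" "int N mod r < r" using assms by simp_all
  moreover have "(d + 1) * r = d * r + r" by (simp add: distrib_right)
  ultimately have N: "d * r \<le> int N" "int N < (d + 1) * r" by linarith+
  show ?case
  proof (cases "int N + 1 = (d + 1) * r")
    case True
    then have "int (Suc N) = (d + 1) * r" by simp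
    then have "int (Suc N) div r = d + 1" using assms by (simp only:) simp
    then have "2 * (\<Sum>t<Suc N. int t div r) + r * (int (Suc N) div r) * (int (Suc N) div r + 1)
        = 2 * (\<Sum>t<N. int t div r) + 2 * d + r * (d + 1) * (d + 2)"
      by (simp add: d_def)
    also have "\<dots> = 2 * int N * d + 2 * d + 2 * ((d + 1) * r)"
      using Suc.IH unfolding d_def[symmetric] by (simp add: algebra_simps)
    also have "\<dots> = 2 * int (Suc N) * (int (Suc N) div r)"
      unfolding \<open>int (Suc N) div r = d + 1\<close> True[symmetric] by (simp add: algebra_simps)
    finally show ?thesis .
  next
    case False
    then have "int (Suc N) div r = d"
      using N by (intro int_div_pos_eq[of _ _ _ "int N + 1 - d * r"]) (auto simp: algebra_simps)
    then show ?thesis using Suc.IH d_def by (simp add: algebra_simps)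
  qed
qed

text \<open>The sum of t div r over t < p r + a is cut once at a and once at p r. In the second cut
  the shift by p r just adds p to each quotient, so \<open>F a\<close>, which depends on a mod r,
  cancels.\<close>

lemma sum_div_shifted:
  fixes r a p :: nat
  assumes "r > 0"
  shows "2 * (\<Sum>t<p*r. (int t + int a) div int r) = int r * int p * (int p - 1) + 2 * int a * int p"
proof -
  define F where "F N = (\<Sum>t<N. int t div int r)" for N
  have split: "F (M + N) = F M + (\<Sum>t<N. (int t + int M) div int r)" for M N
    unfolding F_def by (induction N) (simp_all add: add.commute)
  have "F a + (\<Sum>t<p*r. (int t + int a) div int r) = F (p*r + a)"
    using split[of a "p*r"] by (simp add: add.commute)
  also have "\<dots> = F (p*r) + (\<Sum>t<a. int t div int r + int p)"
    using split[of "p*r" a] assms by (simp add: add.commute)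
  also have "\<dots> = F (p*r) + F a + int a * int p"
    by (simp add: sum.distrib F_def)
  finally have "(\<Sum>t<p*r. (int t + int a) div int r) = F (p*r) + int a * int p" by simp
  moreover have "2 * F (p*r) = int r * int p * (int p - 1)"
    using sum_div_lessThan[of "int r" "p*r"] assms by (simp add: F_def algebra_simps)
  ultimately show ?thesis by simp
qed

text \<open>By coprimality t b mod a runs through a permutation of {0..<a}. So the remainders sum to
  the same value as the t, and division with remainder, summed over t, gives the quotients.\<close>

lemma sum_mult_div_coprime:
  fixes a b :: nat
  assumes "a > 0" "coprime a b"
  shows "2 * (\<Sum>t<a. int (t * b div a)) = (int a - 1) * (int b - 1)"
proof -
  have inj: "inj_on (\<lambda>t. t * b mod a) {..<a}"
  proof (rule inj_onI)
    fix x y assume "x \<in> {..<a}" "y \<in> {..<a}" "x * b mod a = y * b mod a"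
    then have "[x = y] (mod a)"
      using assms(2) cong_mult_rcancel_nat[of b a x y] by (simp add: cong_def coprime_commute)
    then show "x = y" using \<open>x \<in> _\<close> \<open>y \<in> _\<close> by (simp add: cong_def)
  qed
  have "(\<lambda>t. t * b mod a) ` {..<a} = {..<a}"
    using assms(1) by (intro card_subset_eq) (auto simp: card_image[OF inj])
  then have m: "(\<Sum>t<a. int (t * b mod a)) = (\<Sum>t<a. int t)"
    using sum.reindex[OF inj, of int] by (simp add: comp_def)
  have g: "2 * (\<Sum>t<a. int t) = int a * (int a - 1)"
    by (induction a) (simp_all add: algebra_simps)
  have "(\<Sum>t<a. int t) * int b = (\<Sum>t<a. int a * int (t * b div a) + int (t * b mod a))"
    unfolding sum_distrib_right
    by (rule sum.cong) (simp_all flip: of_nat_mult of_nat_add)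
  then have "int a * (\<Sum>t<a. int (t * b div a)) = (\<Sum>t<a. int t) * (int b - 1)"
    by (simp add: sum.distrib sum_distrib_left[symmetric] m algebra_simps)
  then have "int a * (2 * (\<Sum>t<a. int (t * b div a))) = (2 * (\<Sum>t<a. int t)) * (int b - 1)"
    by simp
  then have "int a * (2 * (\<Sum>t<a. int (t * b div a))) = int a * ((int a - 1) * (int b - 1))"
    unfolding g by simp
  then show ?thesis using assms(1) by simp
qed

section \<open>Pell-type numbers\<close>

lemma pell_add2: "pell u (n + 2) = u * pell u (n + 1) + pell u n"
  by (simp add: numeral_2_eq_2)

lemma pell_pos: "u > 0 \<Longrightarrow> n > 0 \<Longrightarrow> pell u n > 0"
  by (induction u n rule: pell.induct) auto

lemma pell_mono:
  assumes "u > 0" "m \<le> n"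
  shows "pell u m \<le> pell u n"
proof (rule lift_Suc_mono_le[OF _ assms(2)])
  fix n
  show "pell u n \<le> pell u (Suc n)"
  proof (cases n)
    case (Suc l)
    have "pell u n * 1 \<le> pell u n * u" using assms(1) by (intro mult_le_mono2) simp
    then show ?thesis using Suc by (simp add: mult.commute trans_le_add1)
  qed simp
qed

lemma pell_less_add2:
  assumes "u > 0"
  shows "pell u n < pell u (n + 2)"
  using pell_pos[OF assms, of "n + 1"] assms unfolding pell_add2 by simp

lemma double_pell_le:
  assumes "u > 0"
  shows "2 * pell u n \<le> pell u (n + 2)"
proof -
  have "pell u n \<le> pell u (n + 1)" using pell_mono[OF assms] by simp
  also have "\<dots> \<le> u * pell u (n + 1)" using assms by simp
  finally show ?thesis unfolding pell_add2 by simp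
qed

text \<open>Makes P_k / u and P_(k-2) / u integers when k is even.\<close>

lemma dvd_pell_even: "u dvd pell u (2 * h)"
  by (induction h) (simp_all add: pell_add2)

lemma coprime_pell_odd: "coprime u (pell u (2 * h + 1))"
proof (induction h)
  case (Suc h)
  have "pell u (2 * Suc h + 1) = pell u (2 * h + 2) * u + pell u (2 * h + 1)"
    by (simp add: mult.commute)
  with Suc.IH show ?case by (simp only: coprime_iff_gcd_eq_1 gcd_add_mult)
qed simp

lemma coprime_pell_Suc: "coprime (pell u n) (pell u (Suc n))"
proof (induction n)
  case (Suc n)
  then show ?case
    by (simp only: pell.simps coprime_iff_gcd_eq_1 gcd_add_mult gcd.commute[of "pell u n"])
qed simp

text \<open>The two terms differ by u P_(2h+2), and P_(2h+1) is coprime to both factors of this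
  product.\<close>

lemma coprime_pell_odd_odd: "coprime (pell u (2 * h + 1)) (pell u (2 * h + 3))"
proof -
  have "pell u (2 * h + 3) = u * pell u (Suc (2 * h + 1)) + pell u (2 * h + 1)"
    by (simp add: eval_nat_numeral)
  moreover have "coprime (pell u (2 * h + 1)) (u * pell u (Suc (2 * h + 1)))"
    using coprime_pell_odd[of u h] coprime_pell_Suc[of u "2 * h + 1"]
    by (simp only: coprime_mult_right_iff coprime_commute)
  ultimately show ?thesis by (metis add.commute coprime_iff_gcd_eq_1 gcd_add2)
qed

lemma pell_add: "pell u (m + n + 1) = pell u (m + 1) * pell u (n + 1) + pell u m * pell u n"
proof (induction n arbitrary: m)
  case (Suc n)
  then show ?case using Suc.IH[of "Suc m"] by (simp add: algebra_simps)
qed simp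

text \<open>Source of the relation c + s a = r b: take m = 2i+1 and n = k-2, then cancel u^2 against
  the even-indexed terms and the factor u.\<close>

lemma pell_three_term:
  "u * pell u (m + n + 2) + pell u n * pell u m = pell u (n + 2) * pell u (m + 2)"
proof -
  have "pell u (m + n + 2) = pell u (m + 1) * pell u (n + 2) + pell u m * pell u (n + 1)"
    using pell_add[of u m "n + 1"] by simp
  then show ?thesis unfolding pell_add2[of u n] pell_add2[of u m]
    by (simp add: algebra_simps del: pell.simps)
qed

section \<open>Three generators with a linear relation\<close>

lemma le_div_iff:
  fixes d :: int
  assumes "0 < d"
  shows "x \<le> y div d \<longleftrightarrow> x * d \<le> y"
proof
  assume "x \<le> y div d"
  then have "x * d \<le> y div d * d" using assms by simp
  also have "\<dots> = y - y mod d" by (simp add: minus_mod_eq_div_mult)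
  also have "\<dots> \<le> y" using assms by simp
  finally show "x * d \<le> y" .
next
  assume "x * d \<le> y"
  then show "x \<le> y div d" using zdiv_mono1[of "x * d" y d] assms by simp
qed

locale three_generators =
  fixes a b c r s :: int
  assumes s_pos: "0 < s" and s_le: "2 * s \<le> r" and r_le: "r \<le> a" and a_le: "a \<le> b"
    and coprime: "coprime a b" and relation: "c + s * a = r * b"
begin

definition reps :: "int \<Rightarrow> (int \<times> int \<times> int) set" where
  "reps n = {(x, y, z). 0 \<le> x \<and> 0 \<le> y \<and> 0 \<le> z \<and> n = x * a + y * b + z * c}"

text \<open>The last two conditions are y >= 0 and x >= 0 for the representation of t b + w a that
  belongs to (j, z). Below, column j means the pairs with this first entry.\<close>

definition sols :: "int \<Rightarrow> int \<Rightarrow> (int \<times> int) set" where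
  "sols t w = {(j, z). 0 \<le> j \<and> 0 \<le> z \<and> 0 \<le> t + j * a - r * z \<and> 0 \<le> w - j * b + s * z}"

text \<open>
  \<open>first_sols p t\<close> consists of the \<open>p\<close> solutions that appear first as \<open>w\<close> grows, and \<open>threshold p t\<close> is the
  least \<open>w\<close> admitting more than \<open>p\<close> solutions; both are correct only for \<open>p \<le> a div r\<close>
  (\<open>p \<le> a div r + 1\<close> for \<open>first_sols\<close>).
\<close>

definition first_sols :: "int \<Rightarrow> int \<Rightarrow> (int \<times> int) set" where
  "first_sols p t = (if p \<le> t div r then {0} \<times> {t div r - p<..t div r}
     else {0} \<times> {0..t div r} \<union> {1} \<times> {(t + a) div r - (p - t div r - 1)<..(t + a) div r})"

definition threshold :: "int \<Rightarrow> int \<Rightarrow> int" where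
  "threshold p t = (if p \<le> t div r then - s * (t div r - p)
     else b - s * ((t + a) div r - (p - t div r - 1)))"

lemma pos: "0 < r" "0 < a" "0 < b"
  using s_pos s_le r_le a_le by linarith+

lemma c_pos: "0 < c"
proof -
  have "s * a \<le> s * b" using s_pos a_le by simp
  moreover have "s * b < r * b" using s_pos s_le pos by simp
  ultimately show ?thesis using relation by linarith
qed

text \<open>Keeps the columns in order. Moving m columns to the right costs m b in the coefficient
  of a, while raising z by X gains s X; the chain 2 s X <= r X < 2 m a <= 2 m b shows that the gain
  never exceeds the cost.\<close>

lemma s_mult_less:
  assumes "r * X < 2 * m * a" "0 \<le> m"
  shows "s * X \<le> m * b"
proof (cases "X \<le> 0")
  case True
  then have "s * X \<le> 0" using s_pos by (simp add: mult_nonneg_nonpos)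
  moreover have "0 \<le> m * b" using assms(2) pos by simp
  ultimately show ?thesis by linarith
next
  case False
  then have "(2 * s) * X \<le> r * X" using s_le by (intro mult_right_mono) auto
  moreover have "m * a \<le> m * b" using assms(2) a_le by (intro mult_left_mono)
  ultimately show ?thesis using assms(1) by simp
qed

lemma finite_reps: "finite (reps n)"
proof -
  have "reps n \<subseteq> {0..n} \<times> {0..n} \<times> {0..n}"
  proof
    fix v assume "v \<in> reps n"
    then obtain x y z where v: "v = (x, y, z)" "0 \<le> x" "0 \<le> y" "0 \<le> z"
      and n: "n = x * a + y * b + z * c"
      unfolding reps_def by blast
    have "x * 1 \<le> x * a" "y * 1 \<le> y * b" "z * 1 \<le> z * c"
      using v pos c_pos by (intro mult_left_mono; simp)+
    then show "v \<in> {0..n} \<times> {0..n} \<times> {0..n}" using v n by simp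
  qed
  then show ?thesis by (rule finite_subset) simp
qed

lemma bij_betw_sols_reps:
  assumes "0 \<le> t" "t < a"
  shows "bij_betw (\<lambda>(j, z). (w - j * b + s * z, t + j * a - r * z, z)) (sols t w) (reps (t * b + w * a))"
proof (rule bij_betw_imageI)
  show "inj_on (\<lambda>(j, z). (w - j * b + s * z, t + j * a - r * z, z)) (sols t w)"
    using pos by (auto simp: inj_on_def)
next
  have "z * c = z * r * b - z * s * a" for z
    using relation by (metis add_diff_cancel_right' mult.assoc right_diff_distrib)
  note c = this
  show "(\<lambda>(j, z). (w - j * b + s * z, t + j * a - r * z, z)) ` sols t w = reps (t * b + w * a)"
  proof (intro equalityI subsetI)
    fix v assume "v \<in> (\<lambda>(j, z). (w - j * b + s * z, t + j * a - r * z, z)) ` sols t w"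
    then show "v \<in> reps (t * b + w * a)"
      unfolding sols_def reps_def by (auto simp: c algebra_simps)
  next
    fix v assume "v \<in> reps (t * b + w * a)"
    then obtain x y z where v: "v = (x, y, z)" "0 \<le> x" "0 \<le> y" "0 \<le> z"
      and n: "t * b + w * a = x * a + y * b + z * c"
      unfolding reps_def by blast
    \<comment> \<open>Eliminating c through the relation leaves only a and b, so coprimality yields
      the quotient j.\<close>
    have e: "(y + r * z - t) * b = (w - x + s * z) * a"
      using n unfolding c by (simp add: algebra_simps)
    then have "a dvd (y + r * z - t) * b" by simp
    then have "a dvd y + r * z - t" using coprime by (simp add: coprime_dvd_mult_left_iff)
    then obtain j where j: "y + r * z - t = a * j" by blast
    have "a * (j * b) = a * (w - x + s * z)"
      using e unfolding j by (simp add: ac_simps)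
    then have x: "x = w - j * b + s * z" using pos by simp
    \<comment> \<open>From y + r z >= 0 and t < a follows a j > -a, which excludes negative
      j.\<close>
    have "0 \<le> r * z" using v pos by simp
    then have "0 < a * (j + 1)" using j v assms by (simp add: algebra_simps)
    then have "0 \<le> j" using pos by (simp add: zero_less_mult_iff)
    moreover have y: "y = t + j * a - r * z" using j by (simp add: algebra_simps)
    ultimately have "(j, z) \<in> sols t w" using v x y unfolding sols_def by simp
    then show "v \<in> (\<lambda>(j, z). (w - j * b + s * z, t + j * a - r * z, z)) ` sols t w"
      using v(1) x y by force
  qed
qed

text \<open>For p <= a div r this ensures that column 1 is long enough: the entries taken from its
  top all have z >= 0.\<close>

lemma shifted_div_ge: "t div r + a div r \<le> (t + a) div r"
  using le_div_iff[OF pos(1), of "t div r + a div r" "t + a"]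
    le_div_iff[OF pos(1), of "t div r" t] le_div_iff[OF pos(1), of "a div r" a]
  by (simp add: distrib_right)

lemma card_first_sols:
  assumes "0 \<le> t" "0 \<le> p"
  shows "int (card (first_sols p t)) = p"
proof (cases "p \<le> t div r")
  case True
  then show ?thesis using assms(2) by (simp add: first_sols_def card_cartesian_product)
next
  case False
  \<comment> \<open>Column 0 has t div r + 1 entries, which leaves p - t div r - 1 for column
    1.\<close>
  have "0 \<le> t div r" using assms pos by (simp add: pos_imp_zdiv_nonneg_iff)
  then show ?thesis using False
    by (subst first_sols_def, subst if_not_P, simp, subst card_Un_disjoint)
       (auto simp: card_cartesian_product)
qed

lemma finite_first_sols: "finite (first_sols p t)"
  by (simp add: first_sols_def)

lemma first_sols_subset:
  assumes t: "0 \<le> t" "t < a" and p: "0 \<le> p" "p \<le> a div r" and w: "threshold p t \<le> w"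
  shows "first_sols (p + 1) t \<subseteq> sols t w"
proof
  define f where "f = t div r"
  define g where "g = (t + a) div r"
  have f: "0 \<le> f" using t pos unfolding f_def by (simp add: pos_imp_zdiv_nonneg_iff)
  have le_f: "z \<le> f \<longleftrightarrow> r * z \<le> t" for z
    unfolding f_def using le_div_iff[OF pos(1)] by (simp add: mult.commute)
  have le_g: "z \<le> g \<longleftrightarrow> r * z \<le> t + a" for z
    unfolding g_def using le_div_iff[OF pos(1)] by (simp add: mult.commute)
  have g: "f + p \<le> g" using shifted_div_ge[of t] p unfolding f_def g_def by linarith
  have W: "threshold p t = (if p \<le> f then - s * (f - p) else b - s * (g - (p - f - 1)))"
    unfolding threshold_def f_def g_def ..
  fix v assume "v \<in> first_sols (p + 1) t"
  \<comment> \<open>For p = f the definition of \<open>first_sols (p + 1) t\<close> is in its second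
    branch, but the column 1 part is then the empty interval {g<..g}; so this value joins the first
    case.\<close>
  then consider z where "v = (0, z)" "0 \<le> z" "f - p \<le> z" "z \<le> f" "p \<le> f"
    | z where "v = (0, z)" "0 \<le> z" "z \<le> f" "f < p"
    | z where "v = (1, z)" "g - (p - f - 1) \<le> z" "z \<le> g" "f < p"
    unfolding first_sols_def f_def[symmetric] g_def[symmetric] using f
    by (cases "p \<le> f") (auto split: if_splits)
  then show "v \<in> sols t w"
  proof cases
    case 1
    then have "s * (f - p) \<le> s * z" using s_pos by simp
    then have "0 \<le> w + s * z" using w W 1 by simp
    moreover have "r * z \<le> t" using 1 le_f by blast
    ultimately show ?thesis using 1(1,2) by (simp add: sols_def)
  next
    case 2
    \<comment> \<open>Since s g <= b, the threshold is nonnegative here, and w >= 0 already admits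
      all of column 0.\<close>
    have "r * g \<le> t + a" using le_g by blast
    then have "s * g \<le> 1 * b" using t by (intro s_mult_less) auto
    moreover have "s * (g - (p - f - 1)) \<le> s * g" using s_pos 2 by simp
    ultimately have "0 \<le> w" using w W 2 by simp
    moreover have "0 \<le> s * z" using s_pos 2 by simp
    ultimately show ?thesis using 2 le_f by (simp add: sols_def)
  next
    case 3
    then have "s * (g - (p - f - 1)) \<le> s * z" using s_pos by simp
    moreover have "0 \<le> z" using 3 g f by linarith
    ultimately show ?thesis using 3 w W le_g by (simp add: sols_def)
  qed
qed

text \<open>A pair (j, z) needs w >= j b - s z. For every pair outside \<open>first_sols p t\<close>
  this bound is at least the threshold: in the column that determines the threshold by comparing z,
  in later columns by \<open>s_mult_less\<close>.\<close>

lemma sols_subset: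
  assumes t: "0 \<le> t" "t < a" and p: "0 \<le> p" "p \<le> a div r" and w: "w < threshold p t"
  shows "sols t w \<subseteq> first_sols p t"
proof
  define f where "f = t div r"
  define g where "g = (t + a) div r"
  have f: "0 \<le> f" using t pos unfolding f_def by (simp add: pos_imp_zdiv_nonneg_iff)
  have le_f: "z \<le> f \<longleftrightarrow> r * z \<le> t" for z
    unfolding f_def using le_div_iff[OF pos(1)] by (simp add: mult.commute)
  have le_g: "z \<le> g \<longleftrightarrow> r * z \<le> t + a" for z
    unfolding g_def using le_div_iff[OF pos(1)] by (simp add: mult.commute)
  have W: "threshold p t = (if p \<le> f then - s * (f - p) else b - s * (g - (p - f - 1)))"
    unfolding threshold_def f_def g_def ..
  fix v assume "v \<in> sols t w"
  then obtain j z where v: "v = (j, z)" "0 \<le> j" "0 \<le> z"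
    and y: "r * z \<le> t + j * a" and x: "j * b - s * z \<le> w"
    unfolding sols_def by auto
  consider "j = 0" | "1 \<le> j" "p \<le> f" | "j = 1" "f < p" | "2 \<le> j" "f < p"
    using v by linarith
  then show "v \<in> first_sols p t"
  proof cases
    case 1
    have "f - p < z" if "p \<le> f"
    proof -
      have "s * (f - p) < s * z" using that x w W 1 by simp
      then show ?thesis using s_pos by simp
    qed
    then show ?thesis
      using v y le_f 1 unfolding first_sols_def f_def[symmetric] by auto
  next
    case 2
    have "1 * a \<le> j * a" using 2 pos by (intro mult_right_mono) auto
    then have "r * z < 2 * j * a" using y t by linarith
    then have "s * z \<le> j * b" using v by (intro s_mult_less)
    moreover have "0 \<le> s * (f - p)" using s_pos 2 by simp
    ultimately show ?thesis using x w W 2 by simp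
  next
    case 3
    have "s * (g - (p - f - 1)) < s * z" using x w W 3 by simp
    then have "g - (p - f - 1) < z" using s_pos by simp
    then show ?thesis
      using v y le_g 3 unfolding first_sols_def f_def[symmetric] g_def[symmetric] by auto
  next
    case 4
    \<comment> \<open>Rewritten with \<open>le_g\<close>, this says r (g + 1) > t + a. Put z' = g -
      (p - f - 1), the entry of column 1 that sets the threshold. As p <= a div r, it follows that r
      z' > t, hence r (z - z') < j a <= 2 (j - 1) a.\<close>
    have "\<not> g + 1 \<le> g" by simp
    then have "t + a < r * g + r" unfolding le_g by (simp add: distrib_left)
    moreover have "r * (p - f - 1) \<le> r * (a div r - 1)"
      using p f pos by (intro mult_left_mono) auto
    moreover have "r * (a div r) \<le> a"
      using le_div_iff[OF pos(1), of "a div r" a] by (simp add: mult.commute)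
    moreover have "2 * a \<le> j * a" using 4 pos by (intro mult_right_mono) auto
    ultimately have "r * (z - (g - (p - f - 1))) < 2 * (j - 1) * a"
      using y by (simp add: algebra_simps)
    then have "s * (z - (g - (p - f - 1))) \<le> (j - 1) * b" using 4 by (intro s_mult_less) auto
    then show ?thesis using x w W 4 by (simp add: algebra_simps)
  qed
qed

lemma card_reps_gt_iff:
  assumes t: "0 \<le> t" "t < a" and p: "0 \<le> p" "p \<le> a div r"
  shows "p < int (card (reps (t * b + w * a))) \<longleftrightarrow> threshold p t \<le> w"
proof -
  have card: "card (reps (t * b + w * a)) = card (sols t w)"
    using bij_betw_same_card[OF bij_betw_sols_reps[OF t]] by simp
  have fin: "finite (sols t w)"
    using bij_betw_finite[OF bij_betw_sols_reps[OF t]] finite_reps by simp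
  show ?thesis
  proof (cases "threshold p t \<le> w")
    case True
    have "card (first_sols (p + 1) t) \<le> card (sols t w)"
      using first_sols_subset[OF t p True] fin by (rule card_mono[rotated])
    then show ?thesis using card_first_sols[of t "p + 1"] t p True card by simp
  next
    case False
    have "card (sols t w) \<le> card (first_sols p t)"
      using sols_subset[OF t p] False by (intro card_mono finite_first_sols) simp
    then show ?thesis using card_first_sols[of t p] t p False card by simp
  qed
qed

section \<open>Counting the gaps class by class\<close>

lemma nonneg_iff: "0 \<le> t * b + w * a \<longleftrightarrow> - (t * b div a) \<le> w"
  using le_div_iff[OF pos(2), of "- w" "t * b"] by auto

text \<open>The number at the threshold has a representation, hence is nonnegative. So the interval
  of gaps in each class has the expected length, without truncation at 0.\<close>

lemma threshold_ge:
  assumes t: "0 \<le> t" "t < a" and p: "0 \<le> p" "p \<le> a div r"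
  shows "- (t * b div a) \<le> threshold p t"
proof -
  have "card (reps (t * b + threshold p t * a)) \<noteq> 0"
    using card_reps_gt_iff[OF t p, of "threshold p t"] p by auto
  then obtain v where "v \<in> reps (t * b + threshold p t * a)"
    by (metis card.empty ex_in_conv)
  then have "0 \<le> t * b + threshold p t * a"
    using pos c_pos by (auto simp: reps_def)
  then show ?thesis by (simp add: nonneg_iff)
qed

lemma bij_betw_gaps:
  assumes p: "0 \<le> p" "p \<le> a div r"
  shows "bij_betw (\<lambda>(t, w). t * b + w * a)
    (SIGMA t:{0..<a}. {- (t * b div a)..<threshold p t}) {n. 0 \<le> n \<and> int (card (reps n)) \<le> p}"
proof (rule bij_betw_imageI)
  show "inj_on (\<lambda>(t, w). t * b + w * a) (SIGMA t:{0..<a}. {- (t * b div a)..<threshold p t})"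
  proof (intro inj_onI, clarsimp)
    fix t w t' w' assume *: "0 \<le> t" "t < a" "0 \<le> t'" "t' < a" "t * b + w * a = t' * b + w' * a"
    then have "(t - t') * b = a * (w' - w)" by (simp add: algebra_simps)
    then have "a dvd (t - t') * b" by simp
    then have "a dvd t - t'" using coprime by (simp add: coprime_dvd_mult_left_iff)
    then have "t = t'" using * by (metis mod_eq_dvd_iff mod_pos_pos_trivial)
    then show "t = t' \<and> w = w'" using * pos by simp
  qed
next
  show "(\<lambda>(t, w). t * b + w * a) ` (SIGMA t:{0..<a}. {- (t * b div a)..<threshold p t})
    = {n. 0 \<le> n \<and> int (card (reps n)) \<le> p}"
  proof (intro equalityI subsetI)
    fix n assume "n \<in> (\<lambda>(t, w). t * b + w * a) ` (SIGMA t:{0..<a}. {- (t * b div a)..<threshold p t})"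
    then obtain t w where tw: "n = t * b + w * a" "0 \<le> t" "t < a" "- (t * b div a) \<le> w" "w < threshold p t"
      by auto
    then show "n \<in> {n. 0 \<le> n \<and> int (card (reps n)) \<le> p}"
      using card_reps_gt_iff[OF tw(2,3) p, of w] nonneg_iff[of t w] by simp
  next
    fix n assume n: "n \<in> {n. 0 \<le> n \<and> int (card (reps n)) \<le> p}"
    \<comment> \<open>With x inverse to b modulo a, the class of n is t = n x mod a.\<close>
    obtain x where "[b * x = 1] (mod a)"
      using cong_solve_coprime_int[of b a] coprime by (auto simp: coprime_commute)
    then have "[n * (b * x) = n * 1] (mod a)" by (intro cong_mult cong_refl)
    moreover have "[(n * x) mod a * b = n * x * b] (mod a)"
      by (intro cong_mult cong_refl) (simp add: cong_def)
    ultimately have "[(n * x) mod a * b = n] (mod a)" by (simp add: ac_simps cong_def)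
    then have "a dvd n - (n * x) mod a * b" by (metis cong_iff_dvd_diff cong_sym)
    then obtain w where w: "n = (n * x) mod a * b + w * a" by (metis add.commute diff_add_cancel dvdE mult.commute)
    define t where "t = (n * x) mod a"
    have t: "0 \<le> t" "t < a" using pos unfolding t_def by simp_all
    have "(t, w) \<in> (SIGMA t:{0..<a}. {- (t * b div a)..<threshold p t})"
      using n t card_reps_gt_iff[OF t p, of w] nonneg_iff[of t w] w unfolding t_def[symmetric] by simp
    then show "n \<in> (\<lambda>(t, w). t * b + w * a) ` (SIGMA t:{0..<a}. {- (t * b div a)..<threshold p t})"
      using w unfolding t_def[symmetric] by force
  qed
qed

lemma card_gaps:
  assumes p: "0 \<le> p" "p \<le> a div r"
  shows "int (card {n. 0 \<le> n \<and> int (card (reps n)) \<le> p}) = (\<Sum>t\<in>{0..<a}. threshold p t + t * b div a)"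
proof -
  have "int (card {n. 0 \<le> n \<and> int (card (reps n)) \<le> p})
      = (\<Sum>t\<in>{0..<a}. int (nat (threshold p t + t * b div a)))"
    unfolding bij_betw_same_card[OF bij_betw_gaps[OF p], symmetric] by simp
  also have "\<dots> = (\<Sum>t\<in>{0..<a}. threshold p t + t * b div a)"
  proof (intro sum.cong refl)
    fix t assume "t \<in> {0..<a}"
    then show "int (nat (threshold p t + t * b div a)) = threshold p t + t * b div a"
      using threshold_ge[of t, OF _ _ p] by simp
  qed
  finally show ?thesis .
qed

lemma sum_threshold:
  assumes p: "0 \<le> p" "p \<le> a div r"
  defines "q \<equiv> a div r"
  shows "2 * (\<Sum>t\<in>{0..<a}. threshold p t) = 2 * p * r * b - s * r * p * (p + 1) - s * (2 * q * a - r * q * (q + 1))"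
proof -
  define A R P where "A = nat a" and "R = nat r" and "P = nat p"
  have ARP: "a = int A" "r = int R" "p = int P" and "R > 0"
    using p pos by (simp_all add: A_def R_def P_def)
  have "p * r \<le> a" using p le_div_iff[OF pos(1)] by simp
  then have le: "P * R \<le> A" unfolding ARP by (simp flip: of_nat_mult)
  \<comment> \<open>The difference between the two branches of \<open>threshold\<close>. It applies
    exactly for t < p r, an initial segment of {0..<a} because p r <= a.\<close>
  define h where "h t = b - s - s * ((int t + a) div r)" for t
  have W: "threshold p (int t) = s * p - s * (int t div r) + (if t < P * R then h t else 0)" for t
  proof -
    have "p \<le> int t div r \<longleftrightarrow> int (P * R) \<le> int t"
      using le_div_iff[OF pos(1), of p "int t"] by (simp add: ARP)
    then have "p \<le> int t div r \<longleftrightarrow> \<not> t < P * R" by linarith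
    then show ?thesis by (simp add: threshold_def h_def algebra_simps)
  qed
  have "(\<Sum>t<A. if t < P * R then h t else 0) = (\<Sum>t<P * R. h t)"
    using le by (simp add: sum.If_cases, intro sum.cong) auto
  moreover have "(\<Sum>t\<in>{0..<a}. threshold p t) = (\<Sum>t<A. threshold p (int t))"
    using sum.atLeast_int_lessThan_int_shift[of "threshold p" 0 A]
    by (simp add: lessThan_atLeast0 comp_def flip: ARP(1))
  moreover have "(\<Sum>t<A. s * p) = a * s * p" by (simp add: ARP(1))
  ultimately have "(\<Sum>t\<in>{0..<a}. threshold p t)
      = a * s * p - s * (\<Sum>t<A. int t div r) + (\<Sum>t<P * R. h t)"
    by (simp only: W sum.distrib sum_subtractf sum_distrib_left)
  moreover have "(\<Sum>t<P * R. h t) = p * r * (b - s) - s * (\<Sum>t<P * R. (int t + a) div r)"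
    by (simp add: h_def sum_subtractf sum_distrib_left ARP)
  ultimately have split: "2 * (\<Sum>t\<in>{0..<a}. threshold p t) = 2 * a * s * p - s * (2 * (\<Sum>t<A. int t div r))
      + 2 * p * r * (b - s) - s * (2 * (\<Sum>t<P * R. (int t + a) div r))"
    by (simp add: algebra_simps)
  have F: "2 * (\<Sum>t<A. int t div r) = 2 * q * a - r * q * (q + 1)"
    using sum_div_lessThan[OF pos(1), of A] unfolding q_def ARP(1)[symmetric]
    by (simp only: ac_simps)
  have G: "2 * (\<Sum>t<P * R. (int t + a) div r) = r * p * (p - 1) + 2 * a * p"
    using sum_div_shifted[OF \<open>R > 0\<close>, of A P] by (simp add: ARP)
  show ?thesis unfolding split F G by (simp add: algebra_simps)
qed

lemma card_gaps_closed_form: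
  assumes p: "0 \<le> p" "p \<le> a div r"
  defines "q \<equiv> a div r"
  shows "2 * int (card {n. 0 \<le> n \<and> int (card (reps n)) \<le> p})
    = 2 * p * r * b - s * r * p * (p + 1) - s * (2 * q * a - r * q * (q + 1)) + (a - 1) * (b - 1)"
proof -
  define A B where "A = nat a" and "B = nat b"
  have AB: "a = int A" "b = int B" using pos by (simp_all add: A_def B_def)
  have "(\<Sum>t\<in>{0..<a}. t * b div a) = (\<Sum>t<A. int (t * B div A))"
    using sum.atLeast_int_lessThan_int_shift[of "\<lambda>t. t * b div a" 0 A]
    by (simp add: AB lessThan_atLeast0 comp_def zdiv_int)
  then have "2 * (\<Sum>t\<in>{0..<a}. t * b div a) = (a - 1) * (b - 1)"
    using sum_mult_div_coprime[of A B] coprime pos by (simp add: AB)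
  then show ?thesis
    unfolding card_gaps[OF p] using sum_threshold[OF p] by (simp add: sum.distrib q_def)
qed

end

section \<open>Transfer to \<open>p_genus\<close>\<close>

lemma card_representations:
  fixes a b c n :: nat
  assumes "a \<noteq> b" "a \<noteq> c" "b \<noteq> c"
  shows "card (representations {a, b, c} n) = card {(x :: int, y :: int, z :: int).
    0 \<le> x \<and> 0 \<le> y \<and> 0 \<le> z \<and> int n = x * int a + y * int b + z * int c}"
proof (rule bij_betw_same_card[OF bij_betw_imageI])
  show "inj_on (\<lambda>x. (int (x a), int (x b), int (x c))) (representations {a, b, c} n)"
    by (auto simp: inj_on_def representations_def intro: PiE_ext[of _ "{a, b, c}" "\<lambda>_. UNIV"])
  have sum: "(\<Sum>t\<in>{a, b, c}. x t * t) = x a * a + x b * b + x c * c" for x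
    using assms by simp
  show "(\<lambda>x. (int (x a), int (x b), int (x c))) ` representations {a, b, c} n
    = {(x, y, z). 0 \<le> x \<and> 0 \<le> y \<and> 0 \<le> z \<and> int n = x * int a + y * int b + z * int c}"
  proof (intro equalityI subsetI)
    fix v assume "v \<in> (\<lambda>x. (int (x a), int (x b), int (x c))) ` representations {a, b, c} n"
    then show "v \<in> {(x, y, z). 0 \<le> x \<and> 0 \<le> y \<and> 0 \<le> z \<and> int n = x * int a + y * int b + z * int c}"
      unfolding representations_def sum by auto
  next
    fix v :: "int \<times> int \<times> int"
    assume "v \<in> {(x, y, z). 0 \<le> x \<and> 0 \<le> y \<and> 0 \<le> z \<and> int n = x * int a + y * int b + z * int c}"
    then obtain x y z where v: "v = (int x, int y, int z)"
      and n: "int n = int x * int a + int y * int b + int z * int c"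
      by (clarsimp, metis nonneg_int_cases)
    \<comment> \<open>Extensional functions take the value \<open>undefined\<close> outside the
      generators.\<close>
    define f where "f = (\<lambda>t. undefined)(a := x, b := y, c := z)"
    have "n = x * a + y * b + z * c" using n by (simp flip: of_nat_mult of_nat_add)
    then have "f \<in> representations {a, b, c} n"
      unfolding representations_def sum using assms by (auto simp: f_def PiE_def extensional_def)
    moreover have "v = (int (f a), int (f b), int (f c))" using assms v by (simp add: f_def)
    ultimately show "v \<in> (\<lambda>x. (int (x a), int (x b), int (x c))) ` representations {a, b, c} n"
      by blast
  qed
qed

text \<open>Doubling keeps the closed form, which contains halves, in the integers. The strict order
  makes the generators three distinct elements.\<close>

lemma p_genus_three_generators:
  fixes a b c r s p :: nat
  assumes "0 < s" "2 * s \<le> r" "r \<le> a" "a < b" "b < c" "coprime a b" "c + s * a = r * b"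
    and "p \<le> a div r"
  defines "q \<equiv> a div r"
  shows "2 * int (p_genus p {a, b, c}) = 2 * int p * int r * int b - int s * int r * int p * (int p + 1)
    - int s * (2 * int q * int a - int r * int q * (int q + 1)) + (int a - 1) * (int b - 1)"
proof -
  have rel: "int c + int s * int a = int r * int b"
    using assms by (simp flip: of_nat_mult of_nat_add)
  interpret three_generators "int a" "int b" "int c" "int r" "int s"
    using assms rel by unfold_locales simp_all
  have card: "card (representations {a, b, c} n) = card (reps (int n))" for n
    using card_representations[of a b c n] assms by (simp add: reps_def)
  have "{n. 0 \<le> n \<and> int (card (reps n)) \<le> int p} = int ` (UNIV - p_semigroup p {a, b, c})"
    unfolding p_semigroup_def card by (auto simp: not_less elim!: nonneg_int_cases)
  then have "p_genus p {a, b, c} = card {n. 0 \<le> n \<and> int (card (reps n)) \<le> int p}"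
    by (simp add: p_genus_def card_image)
  moreover have "int p \<le> int a div int r" using assms(8) by (simp flip: zdiv_int)
  ultimately show ?thesis using card_gaps_closed_form[of "int p"] by (simp add: q_def zdiv_int)
qed

section \<open>The Pell-type triple\<close>

theorem theorem6:
  fixes u i k p :: nat and q :: int
  assumes "u > 0" and "i \<ge> 2" and "even k" and "4 \<le> k" and "k \<le> 2 * i"
    and "q = \<lfloor>real u * real (pell u (2*i+1)) / real (pell u k)\<rfloor>"
    and "int p \<le> q"
  shows "real (p_genus p {pell u (2*i+1), pell u (2*i+3), pell u (2*i+k+1)}) =
      - ((real p)^2 * real (pell u k) * real (pell u (k-2)) / (2 * (real u)^2))
      + real p / (2 * (real u)^2) * real (pell u k)
          * (2 * real u * real (pell u (2*i+3)) - real (pell u (k-2)))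
      + 1 / (2 * (real u)^2)
          * ((real u)^2 * (real (pell u (2*i+1)) - 1) * (real (pell u (2*i+3)) - 1)
             - real_of_int q * real (pell u (k-2))
                 * (2 * real u * real (pell u (2*i+1)) - (real_of_int q + 1) * real (pell u k)))"
proof -
  define a b c where "a = pell u (2*i+1)" and "b = pell u (2*i+3)" and "c = pell u (2*i+k+1)"
  obtain h where h: "k = 2 * h + 2" "1 \<le> h"
    using assms(3,4) by (auto elim!: evenE intro: that[of "k div 2 - 1"])
  obtain r where r: "pell u k = u * r"
    using dvd_pell_even[of u "h + 1"] h by (auto elim: dvdE)
  obtain s where s: "pell u (k - 2) = u * s"
    using dvd_pell_even[of u h] h by (auto elim: dvdE)
  have "0 < s" using pell_pos[OF assms(1), of "k - 2"] h s by simp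
  moreover have "2 * s \<le> r"
  proof -
    have "k - 2 + 2 = k" using h by simp
    then have "u * (2 * s) \<le> u * r" using double_pell_le[OF assms(1), of "k - 2"] r s by simp
    then show ?thesis using assms(1) by simp
  qed
  moreover have "r \<le> a"
  proof -
    have "1 * r \<le> u * r" using assms(1) by (intro mult_right_mono) auto
    also have "\<dots> \<le> a"
      unfolding r[symmetric] a_def using assms by (intro pell_mono) auto
    finally show ?thesis by simp
  qed
  moreover have "a < b"
  proof -
    have "2*i+1 + 2 = 2*i+3" by simp
    then show ?thesis unfolding a_def b_def using pell_less_add2[OF assms(1)] by metis
  qed
  moreover have "b < c"
  proof -
    have "b < pell u (2*i+3 + 2)" unfolding b_def by (rule pell_less_add2[OF assms(1)])
    \<comment> \<open>Here k >= 4 gives 2i + k + 1 >= 2i + 5.\<close>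
    also have "\<dots> \<le> c" unfolding c_def using assms by (intro pell_mono) auto
    finally show ?thesis .
  qed
  moreover have "coprime a b" unfolding a_def b_def by (rule coprime_pell_odd_odd)
  moreover have "c + s * a = r * b"
  proof -
    have idx: "2*i+1 + (k-2) + 2 = 2*i+k+1" "2*i+1 + 2 = 2*i+3" "k - 2 + 2 = k"
      using h by simp_all
    have "u * (c + s * a) = u * (r * b)"
      using pell_three_term[of u "2*i+1" "k-2"]
      unfolding idx r s a_def[symmetric] b_def[symmetric] c_def[symmetric]
      by (simp add: distrib_left)
    then show ?thesis using assms(1) by simp
  qed
  \<comment> \<open>Since P_k = u r, the factor u cancels in u a / P_k, and the floor becomes a div
    r.\<close>
  moreover have q: "q = int (a div r)"
    using assms(1) unfolding assms(6) r a_def[symmetric] by (simp add: floor_divide_of_nat_eq)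
  moreover have "p \<le> a div r" using assms(7) q by simp
  ultimately have "2 * int (p_genus p {a, b, c}) = 2 * int p * int r * int b
    - int s * int r * int p * (int p + 1) - int s * (2 * q * int a - int r * q * (q + 1)) + (int a - 1) * (int b - 1)"
    using p_genus_three_generators[of s r a b c p] by simp
  then have "real_of_int (2 * int (p_genus p {a, b, c})) = real_of_int (2 * int p * int r * int b
    - int s * int r * int p * (int p + 1) - int s * (2 * q * int a - int r * q * (q + 1)) + (int a - 1) * (int b - 1))"
    by (simp only:)
  then have genus: "real (p_genus p {a, b, c}) = (2 * real p * real r * real b
    - real s * real r * real p * (real p + 1)
    - real s * (2 * real_of_int q * real a - real r * real_of_int q * (real_of_int q + 1))
    + (real a - 1) * (real b - 1)) / 2"
    by simp
  show ?thesis
    using assms(1) unfolding a_def[symmetric] b_def[symmetric] c_def[symmetric] r s genus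
    by (simp add: field_simps power2_eq_square)
qed

end
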